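(* For every positive integer $r$ there exist a constant $c_r>0$ and a function $\tau_r:\mathbb{N}\to[0,\infty)$ with $\tau_r(N)\to 0$ as $N\to\infty$ such that the following holds for every positive integer $N$. For any $r$-colouring $C_1\cup\dots\cup C_r=\{1,2,\dots,N\}$ there exists a colour class $C_j$ such that $$\sum_{x-y=z^2}1_{C_j}(x)1_{C_j}(y)1_{C_j}(z)\ \ge\ c_r\,N^{3/2^r}\,(1-\tau_r(N)),$$ where the sum is over all integer triples $(x,y,z)$ with $x-y=z^2$.
   Context: $\mathbb{N}$ denotes the positive integers. An $r$-colouring of a set is a partition of it into $r$ (possibly empty) parts, called colour classes. $1_C$ denotes the indicator function of $C$. *)

theory Defs
  imports "HOL-Analysis.Analysis"
begin

text \<open>The classes are indexed by \<open>1, \<dots>, r\<close> and may be empty, so \<^const>\<open>partition_on\<close> does not apply.\<close>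

definition colouring :: "nat \<Rightarrow> 'a set \<Rightarrow> (nat \<Rightarrow> 'a set) \<Rightarrow> bool" where
  "colouring r S C \<longleftrightarrow> disjoint_family_on C {1..r} \<and> (\<Union>i\<in>{1..r}. C i) = S"

text \<open>The index set is infinite, hence \<^const>\<open>infsum\<close>. For finite \<open>A\<close> only finitely many terms are
  nonzero and the value is the number of solutions in \<open>A\<close>; see \<open>square_diff_sum_eq_card\<close>.\<close>

definition square_diff_sum :: "int set \<Rightarrow> real" where
  "square_diff_sum A =
     (\<Sum>\<^sub>\<infinity>(x, y, z)\<in>{(x, y, z). x - y = z\<^sup>2}. indicator A x * indicator A y * indicator A z)"

lemma square_diff_sum_eq_card:
  assumes "finite A"
  shows "square_diff_sum A = real (card {(x, y, z). x \<in> A \<and> y \<in> A \<and> z \<in> A \<and> x - y = z\<^sup>2})"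
proof -
  let ?T = "{(x, y, z). x \<in> A \<and> y \<in> A \<and> z \<in> A \<and> x - y = z\<^sup>2}"
  have "?T \<subseteq> A \<times> A \<times> A"
    by auto
  then have fin: "finite ?T"
    by (rule finite_subset) (use assms in simp)
  have "square_diff_sum A = (\<Sum>\<^sub>\<infinity>t\<in>?T. 1)"
    unfolding square_diff_sum_def
    by (rule infsum_cong_neutral) (auto simp: indicator_def)
  also have "\<dots> = real (card ?T)"
    using fin by simp
  finally show ?thesis .
qed

end

theory Submission
  imports Defs "HOL-Real_Asymp.Real_Asymp"
begin

text \<open>
  The solutions are found at one of the scales \<open>N, N\<^sup>1\<^sup>/\<^sup>2, N\<^sup>1\<^sup>/\<^sup>4, \<dots>\<close>. Some colour class \<open>C\<^sub>1\<close> is dense in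
  \<open>{1..N}\<close>. Squares are a set of recurrence for density, so for every \<open>d\<close> up to a small multiple of
  \<open>N\<^sup>1\<^sup>/\<^sup>2\<close> some bounded multiple \<open>w\<close> of \<open>d\<close> is popular: \<open>x, x + w\<^sup>2 \<in> C\<^sub>1\<close> for a positive proportion
  of all \<open>x\<close>. The popular \<open>w\<close> have positive density at scale \<open>N\<^sup>1\<^sup>/\<^sup>2\<close>, so some class contains a
  positive proportion of them. If that class is \<open>C\<^sub>1\<close>, it has about \<open>N\<^sup>3\<^sup>/\<^sup>2\<close> solutions. If it
  is another class \<open>C\<^sub>2\<close>, then \<open>C\<^sub>2\<close> is dense at scale \<open>N\<^sup>1\<^sup>/\<^sup>2\<close>, and one looks for \<open>w\<close> of size \<open>N\<^sup>1\<^sup>/\<^sup>4\<close>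
  that are popular for \<open>C\<^sub>1\<close> at scale \<open>N\<close> and at the same time for \<open>C\<^sub>2\<close> at scale \<open>N\<^sup>1\<^sup>/\<^sup>2\<close>. Each
  failure adds a new class, so the process ends after at most \<open>r\<close> rounds. In the worst case
  the popular \<open>w\<close> have size \<open>N\<close> to the power \<open>1 / 2 ^ r\<close> and each of them gives \<open>N\<close> to the power
  \<open>2 / 2 ^ r\<close> solutions, which is the exponent of the theorem. One round is
  \<open>dense_classes_step\<close>.

  A \<open>w\<close> that is popular for several sets at several scales comes from recurrence in the product of
  these sets (\<open>simultaneous_square_returns\<close>). The only input is the Furstenberg-Sarkozy theorem
  \<open>furstenberg_sarkozy\<close>: a dense set of integers contains two elements that differ by a square.
  Its proof here is qualitative and uses no Fourier analysis. Take a set without square differences whose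
  density \<open>\<delta>\<close> is almost the largest possible for long intervals. Its trace on any progression with
  square common difference is, after rescaling, again free of square differences and so
  has density at most about \<open>\<delta>\<close>; as the average is \<open>\<delta>\<close>, the set has density
  close to \<open>\<delta>\<close> on almost all these progressions. The van der Corput inequality
  (\<open>van_der_Corput_squares\<close>) turns this into uniform distribution along the shifts by squares, and
  then a typical square would be the difference of about \<open>\<delta>\<^sup>2 N\<close> pairs of elements.\<close>

section \<open>Averages along squares\<close>

text \<open>The case \<open>z = 0\<close> is excluded because every element differs from itself by \<open>0\<^sup>2\<close>.\<close>

definition square_difference_free :: "nat set \<Rightarrow> bool" where
  "square_difference_free A \<longleftrightarrow> (\<forall>x\<in>A. \<forall>z>0. x + z\<^sup>2 \<notin> A)"

text \<open>Periodic functions take the place of functions on a finite interval, so that shifting a sum produces no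
  boundary terms.\<close>

lemma sum_shift_periodic:
  fixes f :: "nat \<Rightarrow> real"
  assumes "\<And>x. f (x + N) = f x"
  shows "(\<Sum>x<N. f (x + k)) = (\<Sum>x<N. f x)"
proof (induction k)
  case (Suc k)
  have "(\<Sum>x<Suc N. f (x + k)) = f k + (\<Sum>x<N. f (x + Suc k))"
    by (subst sum.lessThan_Suc_shift) simp
  moreover have "(\<Sum>x<Suc N. f (x + k)) = (\<Sum>x<N. f (x + k)) + f k"
    using assms[of k] by (simp add: add.commute)
  ultimately show ?case
    using Suc by simp
qed simp

text \<open>The difference of two shifted squares is linear in the running variable:
  \<open>(z + h + k + 1)\<^sup>2 - (z + h + 1)\<^sup>2 = 2 k z + e\<close> with \<open>e\<close> independent of \<open>z\<close>. Correlations along squares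
  are therefore controlled by averages along progressions of difference \<open>2 k\<close>.\<close>

lemma correlation_of_square_shifts_le:
  fixes f :: "nat \<Rightarrow> real"
  assumes per: "\<And>x. f (x + N) = f x" and bd: "\<And>x. \<bar>f x\<bar> \<le> 1"
  shows "(\<Sum>z<Z. \<Sum>x<N. f (x + (z + h + 1)\<^sup>2) * f (x + (z + (h + k) + 1)\<^sup>2))
           \<le> (\<Sum>x<N. \<bar>\<Sum>z<Z. f (x + 2 * k * z)\<bar>)"
proof -
  define e where "e = 2 * k * (h + 1) + k\<^sup>2"
  have "(\<Sum>z<Z. \<Sum>x<N. f (x + (z + h + 1)\<^sup>2) * f (x + (z + (h + k) + 1)\<^sup>2))
      = (\<Sum>z<Z. \<Sum>x<N. f x * f (x + (2 * k * z + e)))"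
  proof (rule sum.cong[OF refl])
    fix z
    have sq: "(z + (h + k) + 1)\<^sup>2 = (z + h + 1)\<^sup>2 + (2 * k * z + e)"
      by (simp add: e_def power2_eq_square algebra_simps)
    have per': "f (x + N) * f (x + N + (2 * k * z + e)) = f x * f (x + (2 * k * z + e))" for x
      using per[of x] per[of "x + (2 * k * z + e)"] by (simp add: ac_simps)
    show "(\<Sum>x<N. f (x + (z + h + 1)\<^sup>2) * f (x + (z + (h + k) + 1)\<^sup>2))
        = (\<Sum>x<N. f x * f (x + (2 * k * z + e)))"
      using sum_shift_periodic[of "\<lambda>x. f x * f (x + (2 * k * z + e))" N "(z + h + 1)\<^sup>2", OF per']
      unfolding sq by (simp only: add.assoc)
  qed
  also have "\<dots> = (\<Sum>x<N. f x * (\<Sum>z<Z. f (x + e + 2 * k * z)))"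
    by (subst sum.swap) (simp add: sum_distrib_left ac_simps)
  also have "\<dots> \<le> (\<Sum>x<N. \<bar>\<Sum>z<Z. f (x + e + 2 * k * z)\<bar>)"
  proof (rule sum_mono)
    fix x
    have "f x * (\<Sum>z<Z. f (x + e + 2 * k * z)) \<le> \<bar>f x\<bar> * \<bar>\<Sum>z<Z. f (x + e + 2 * k * z)\<bar>"
      by (metis abs_ge_self abs_mult)
    also have "\<dots> \<le> 1 * \<bar>\<Sum>z<Z. f (x + e + 2 * k * z)\<bar>"
      by (intro mult_right_mono bd) simp
    finally show "f x * (\<Sum>z<Z. f (x + e + 2 * k * z)) \<le> \<bar>\<Sum>z<Z. f (x + e + 2 * k * z)\<bar>"
      by simp
  qed
  also have "\<dots> = (\<Sum>x<N. \<bar>\<Sum>z<Z. f (x + 2 * k * z)\<bar>)"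
  proof (rule sum_shift_periodic)
    fix x
    have "f (x + N + 2 * k * z) = f (x + 2 * k * z)" for z
      using per[of "x + 2 * k * z"] by (simp add: ac_simps)
    then show "\<bar>\<Sum>z<Z. f (x + N + 2 * k * z)\<bar> = \<bar>\<Sum>z<Z. f (x + 2 * k * z)\<bar>"
      by simp
  qed
  finally show ?thesis .
qed

text \<open>The Cauchy-Schwarz inequality in \<open>z\<close> leaves correlations of the shifts by \<open>(z + h + 1)\<^sup>2\<close> and
  \<open>(z + h' + 1)\<^sup>2\<close>. The \<open>H\<close> diagonal terms are bounded trivially, which costs a factor \<open>1 / H\<close> relative
  to the trivial bound, and the others by the averages along progressions. The averaging over \<open>h\<close> is
  part of the left-hand side: only the existence of some square difference is wanted later,
  and any weighted average over squares serves for that.\<close>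

lemma van_der_Corput_squares:
  fixes f :: "nat \<Rightarrow> real" and \<epsilon> :: real and N Z H :: nat
  assumes per: "\<And>x. f (x + N) = f x" and bd: "\<And>x. \<bar>f x\<bar> \<le> 1" and "\<epsilon> \<ge> 0"
    and lin: "\<And>k. k \<in> {1..<H} \<Longrightarrow> (\<Sum>x<N. \<bar>\<Sum>z<Z. f (x + 2 * k * z)\<bar>) \<le> \<epsilon> * N * Z"
  shows "(\<Sum>x<N. (\<Sum>z<Z. \<Sum>h<H. f (x + (z + h + 1)\<^sup>2))\<^sup>2) \<le> real (N * Z\<^sup>2) * (H + \<epsilon> * H\<^sup>2)"
proof -
  define Q where "Q h h' = (\<Sum>z<Z. \<Sum>x<N. f (x + (z + h + 1)\<^sup>2) * f (x + (z + h' + 1)\<^sup>2))" for h h'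
  have Q_sym: "Q h h' = Q h' h" for h h'
    by (simp add: Q_def mult.commute)
  have Q_less: "Q h h' \<le> \<epsilon> * N * Z" if "h < h'" "h' < H" for h h'
  proof -
    have k: "h' = h + (h' - h)" "h' - h \<in> {1..<H}"
      using that by auto
    show ?thesis
      using correlation_of_square_shifts_le[where f = f and N = N, OF per bd,
          where h = h and k = "h' - h" and Z = Z] lin[OF k(2)] k(1)
      by (simp add: Q_def)
  qed
  have Q_diag: "Q h h \<le> N * Z" for h
  proof -
    have "f y * f y \<le> 1" for y
      using bd[of y] by (metis abs_mult abs_mult_self_eq abs_ge_zero mult_le_one)
    then have "Q h h \<le> (\<Sum>z<Z. \<Sum>x<N. 1)"
      unfolding Q_def by (intro sum_mono)
    then show ?thesis
      by (simp add: mult.commute)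
  qed
  have Q_le: "Q h h' \<le> (if h = h' then real N * Z else 0) + \<epsilon> * N * Z" if "h < H" "h' < H" for h h'
    using Q_diag[of h] Q_less[of h h'] Q_less[of h' h] Q_sym[of h h'] that \<open>\<epsilon> \<ge> 0\<close>
    by (cases h h' rule: linorder_cases) (auto intro: add_increasing2)
  have sum_sq: "(\<Sum>h<H. g h)\<^sup>2 = (\<Sum>h<H. \<Sum>h'<H. g h * g h')" for g :: "nat \<Rightarrow> real"
    by (simp add: power2_eq_square sum_product)
  have "(\<Sum>x<N. \<Sum>z<Z. \<Sum>h<H. \<Sum>h'<H. f (x + (z + h + 1)\<^sup>2) * f (x + (z + h' + 1)\<^sup>2))
      = (\<Sum>z<Z. \<Sum>x<N. \<Sum>h<H. \<Sum>h'<H. f (x + (z + h + 1)\<^sup>2) * f (x + (z + h' + 1)\<^sup>2))"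
    by (rule sum.swap)
  also have "\<dots> = (\<Sum>z<Z. \<Sum>h<H. \<Sum>x<N. \<Sum>h'<H. f (x + (z + h + 1)\<^sup>2) * f (x + (z + h' + 1)\<^sup>2))"
    by (rule sum.cong[OF refl], rule sum.swap)
  also have "\<dots> = (\<Sum>h<H. \<Sum>z<Z. \<Sum>x<N. \<Sum>h'<H. f (x + (z + h + 1)\<^sup>2) * f (x + (z + h' + 1)\<^sup>2))"
    by (rule sum.swap)
  also have "\<dots> = (\<Sum>h<H. \<Sum>z<Z. \<Sum>h'<H. \<Sum>x<N. f (x + (z + h + 1)\<^sup>2) * f (x + (z + h' + 1)\<^sup>2))"
    by (rule sum.cong[OF refl], rule sum.cong[OF refl], rule sum.swap)
  also have "\<dots> = (\<Sum>h<H. \<Sum>h'<H. Q h h')"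
    unfolding Q_def by (rule sum.cong[OF refl], rule sum.swap)
  also have "\<dots> \<le> (\<Sum>h<H. \<Sum>h'<H. (if h = h' then real N * Z else 0) + \<epsilon> * N * Z)"
    by (intro sum_mono Q_le) auto
  also have "\<dots> = N * Z * (H + \<epsilon> * H\<^sup>2)"
    by (simp add: sum.distrib power2_eq_square algebra_simps)
  finally have total: "(\<Sum>x<N. \<Sum>z<Z. \<Sum>h<H. \<Sum>h'<H. f (x + (z + h + 1)\<^sup>2) * f (x + (z + h' + 1)\<^sup>2))
      \<le> N * Z * (H + \<epsilon> * H\<^sup>2)" .
  have "(\<Sum>x<N. (\<Sum>z<Z. \<Sum>h<H. f (x + (z + h + 1)\<^sup>2))\<^sup>2)
      \<le> (\<Sum>x<N. Z * (\<Sum>z<Z. (\<Sum>h<H. f (x + (z + h + 1)\<^sup>2))\<^sup>2))"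
    using sum_squared_le_sum_of_squares[where I = "{..<Z}"]
    by (intro sum_mono) (simp add: mult.commute)
  also have "\<dots> = Z * (\<Sum>x<N. \<Sum>z<Z. \<Sum>h<H. \<Sum>h'<H. f (x + (z + h + 1)\<^sup>2) * f (x + (z + h' + 1)\<^sup>2))"
    by (simp only: sum_sq sum_distrib_left)
  also have "\<dots> \<le> Z * (N * Z * (H + \<epsilon> * H\<^sup>2))"
    using total by (intro mult_left_mono) auto
  finally show ?thesis
    by (simp add: power2_eq_square ac_simps)
qed

section \<open>Distribution of extremal sets in arithmetic progressions\<close>

definition balanced_indicator :: "nat set \<Rightarrow> nat \<Rightarrow> real \<Rightarrow> nat \<Rightarrow> real" where
  "balanced_indicator A N \<delta> x = indicator A (x mod N) - \<delta>"

lemma balanced_indicator_periodic: "balanced_indicator A N \<delta> (x + N) = balanced_indicator A N \<delta> x"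
  by (simp add: balanced_indicator_def)

lemma abs_balanced_indicator_le_1:
  assumes "0 \<le> \<delta>" "\<delta> \<le> 1"
  shows "\<bar>balanced_indicator A N \<delta> x\<bar> \<le> 1"
  using assms by (auto simp: balanced_indicator_def indicator_def)

lemma sum_balanced_indicator:
  fixes \<delta> :: real
  assumes "A \<subseteq> {..<N}"
  shows "(\<Sum>x<N. balanced_indicator A N \<delta> x) = card A - \<delta> * N"
proof -
  have "(\<Sum>x<N. indicator A (x mod N)) = (\<Sum>x<N. indicator A x :: real)"
    by (intro sum.cong) auto
  also have "\<dots> = card A"
    using assms by (simp add: indicator_def sum.If_cases Int_absorb1)
  finally show ?thesis
    by (simp add: balanced_indicator_def sum_subtractf mult.commute)
qed

text \<open>If \<open>A\<close> has no square differences, neither has \<open>{w. x + q\<^sup>2 w \<in> A}\<close>, since \<open>q\<^sup>2 z\<^sup>2 = (q z)\<^sup>2\<close>. The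
  assumption \<open>x + q\<^sup>2 W \<le> N\<close> keeps the progression from wrapping around modulo \<open>N\<close>.\<close>

lemma sum_balanced_indicator_along_square_progression:
  fixes \<delta> \<eta> :: real
  assumes ext: "\<And>B. B \<subseteq> {..<W} \<Longrightarrow> square_difference_free B \<Longrightarrow> card B \<le> (\<delta> + \<eta>) * W"
    and A: "square_difference_free A" and q: "q > 0" and x: "x + q\<^sup>2 * W \<le> N"
  shows "(\<Sum>w<W. balanced_indicator A N \<delta> (x + q\<^sup>2 * w)) \<le> \<eta> * W"
proof -
  define B where "B = {w. w < W \<and> x + q\<^sup>2 * w \<in> A}"
  have "square_difference_free B"
    unfolding square_difference_free_def
  proof (intro ballI allI impI notI)
    fix w z assume "w \<in> B" "z > 0" "w + z\<^sup>2 \<in> B"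
    then have "x + q\<^sup>2 * w \<in> A" "(x + q\<^sup>2 * w) + (q * z)\<^sup>2 \<in> A" "q * z > 0"
      using q by (auto simp: B_def power_mult_distrib algebra_simps)
    then show False
      using A by (auto simp: square_difference_free_def)
  qed
  then have "card B \<le> (\<delta> + \<eta>) * W"
    by (intro ext) (auto simp: B_def)
  moreover have "(\<Sum>w<W. indicator A ((x + q\<^sup>2 * w) mod N)) = (\<Sum>w<W. indicator B w :: real)"
  proof (rule sum.cong[OF refl])
    fix w assume w: "w \<in> {..<W}"
    then have "q\<^sup>2 * w < q\<^sup>2 * W"
      using q by simp
    then have "x + q\<^sup>2 * w < N"
      using x by linarith
    then show "indicator A ((x + q\<^sup>2 * w) mod N) = (indicator B w :: real)"
      using w by (auto simp: B_def indicator_def)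
  qed
  moreover have "(\<Sum>w<W. indicator B w :: real) = card B"
    by (simp add: B_def indicator_def sum.If_cases Int_def)
  ultimately show ?thesis
    by (simp add: balanced_indicator_def sum_subtractf algebra_simps)
qed

text \<open>An upper bound for the density on every progression yields an \<open>L\<^sup>1\<close> bound, because the mean of
  the deviations is almost \<open>0\<close>: \<open>\<bar>K\<bar> = 2 max K 0 - K\<close>. The second error term comes from the progressions
  that wrap around.\<close>

lemma L1_along_square_progressions:
  fixes \<delta> \<eta> :: real
  assumes ext: "\<And>B. B \<subseteq> {..<W} \<Longrightarrow> square_difference_free B \<Longrightarrow> card B \<le> (\<delta> + \<eta>) * W"
    and A: "A \<subseteq> {..<N}" "square_difference_free A" "card A \<ge> (\<delta> - \<eta>) * N"
    and \<delta>: "0 \<le> \<delta>" "\<delta> \<le> 1" and \<eta>: "\<eta> \<ge> 0" and q: "q > 0"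
  shows "(\<Sum>x<N. \<bar>\<Sum>w<W. balanced_indicator A N \<delta> (x + q\<^sup>2 * w)\<bar>)
           \<le> W * (3 * \<eta> * N + real (2 * q\<^sup>2 * W))"
proof -
  let ?f = "balanced_indicator A N \<delta>"
  define K where "K x = (\<Sum>w<W. ?f (x + q\<^sup>2 * w))" for x
  have K_le: "max (K x) 0 \<le> \<eta> * W + (if N - q\<^sup>2 * W \<le> x then real W else 0)" if "x < N" for x
  proof (cases "x + q\<^sup>2 * W \<le> N")
    case True
    then have "K x \<le> \<eta> * W"
      unfolding K_def by (intro sum_balanced_indicator_along_square_progression ext A q)
    then show ?thesis
      using \<eta> by (auto simp: add_increasing2)
  next
    case False
    have "K x \<le> (\<Sum>w<W. 1)"
      unfolding K_def using abs_balanced_indicator_le_1[OF \<delta>] by (intro sum_mono) (meson abs_le_D1)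
    then show ?thesis
      using \<eta> False by (auto simp: add_increasing)
  qed
  have "card {x. x < N \<and> N - q\<^sup>2 * W \<le> x} \<le> card {N - q\<^sup>2 * W..<N}"
    by (intro card_mono) auto
  then have card_bad: "card {x. x < N \<and> N - q\<^sup>2 * W \<le> x} \<le> q\<^sup>2 * W"
    by simp
  have "(\<Sum>x<N. max (K x) 0) \<le> (\<Sum>x<N. \<eta> * W + (if N - q\<^sup>2 * W \<le> x then real W else 0))"
    by (intro sum_mono K_le) auto
  also have "\<dots> = \<eta> * W * N + card {x. x < N \<and> N - q\<^sup>2 * W \<le> x} * real W"
    by (simp add: sum.distrib sum.If_cases Int_def)
  also have "\<dots> \<le> \<eta> * W * N + (real (q\<^sup>2 * W)) * W"
    using card_bad by (intro add_left_mono mult_right_mono of_nat_mono) auto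
  finally have pos: "(\<Sum>x<N. max (K x) 0) \<le> \<eta> * W * N + (real (q\<^sup>2 * W)) * W" .
  have "(\<Sum>x<N. K x) = (\<Sum>w<W. \<Sum>x<N. ?f (x + q\<^sup>2 * w))"
    unfolding K_def by (rule sum.swap)
  also have "\<dots> = (\<Sum>w<W. card A - \<delta> * N)"
    using sum_shift_periodic[of ?f N, OF balanced_indicator_periodic] sum_balanced_indicator[OF A(1)]
    by simp
  also have "\<dots> = W * (card A - \<delta> * N)"
    by simp
  also have "\<dots> \<ge> W * (- \<eta> * N)"
    using A(3) by (intro mult_left_mono) (auto simp: algebra_simps)
  finally have tot: "(\<Sum>x<N. K x) \<ge> W * (- \<eta> * N)" .
  have "(\<Sum>x<N. \<bar>K x\<bar>) = (\<Sum>x<N. 2 * max (K x) 0 - K x)"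
    by (intro sum.cong) auto
  also have "\<dots> = 2 * (\<Sum>x<N. max (K x) 0) - (\<Sum>x<N. K x)"
    by (simp add: sum_subtractf sum_distrib_left)
  also have "\<dots> \<le> 2 * (\<eta> * W * N + (real (q\<^sup>2 * W)) * W) - W * (- \<eta> * N)"
    by (intro diff_mono mult_left_mono pos tot) simp
  also have "\<dots> = W * (3 * \<eta> * N + real (2 * q\<^sup>2 * W))"
    by (simp add: algebra_simps)
  finally show ?thesis
    by (simp add: K_def)
qed

text \<open>The van der Corput inequality produces progressions of difference \<open>2 k\<close>. Each of them splits into
  \<open>2 k\<close> progressions whose difference \<open>(2 k)\<^sup>2\<close> is a square.\<close>

lemma L1_along_progressions:
  fixes \<delta> \<eta> :: real
  assumes ext: "\<And>B. B \<subseteq> {..<W} \<Longrightarrow> square_difference_free B \<Longrightarrow> card B \<le> (\<delta> + \<eta>) * W"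
    and A: "A \<subseteq> {..<N}" "square_difference_free A" "card A \<ge> (\<delta> - \<eta>) * N"
    and \<delta>: "0 \<le> \<delta>" "\<delta> \<le> 1" and \<eta>: "\<eta> \<ge> 0" and k: "k > 0"
  shows "(\<Sum>x<N. \<bar>\<Sum>z<2 * k * W. balanced_indicator A N \<delta> (x + 2 * k * z)\<bar>)
           \<le> real (2 * k * W) * (3 * \<eta> * N + real (2 * (2 * k)\<^sup>2 * W))"
proof -
  let ?f = "balanced_indicator A N \<delta>" and ?q = "2 * k"
  have split: "(\<Sum>z<?q * W. ?f (x + ?q * z)) = (\<Sum>s<?q. \<Sum>w<W. ?f (x + ?q * s + ?q\<^sup>2 * w))" for x
  proof -
    have "(\<Sum>z<?q * W. ?f (x + ?q * z)) = (\<Sum>w<W. \<Sum>z\<in>{w * ?q..<w * ?q + ?q}. ?f (x + ?q * z))"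
      by (subst sum.nat_group) (simp add: mult.commute)
    also have "\<dots> = (\<Sum>w<W. \<Sum>s<?q. ?f (x + ?q * s + ?q\<^sup>2 * w))"
    proof (rule sum.cong[OF refl])
      fix w
      have "(\<Sum>z\<in>{w * ?q..<w * ?q + ?q}. ?f (x + ?q * z)) = (\<Sum>s<?q. ?f (x + ?q * (s + w * ?q)))"
        using sum.shift_bounds_nat_ivl[of "\<lambda>z. ?f (x + ?q * z)" 0 "w * ?q" ?q]
        by (simp add: atLeast0LessThan add.commute)
      then show "(\<Sum>z\<in>{w * ?q..<w * ?q + ?q}. ?f (x + ?q * z)) = (\<Sum>s<?q. ?f (x + ?q * s + ?q\<^sup>2 * w))"
        by (simp add: power2_eq_square algebra_simps)
    qed
    also have "\<dots> = (\<Sum>s<?q. \<Sum>w<W. ?f (x + ?q * s + ?q\<^sup>2 * w))"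
      by (rule sum.swap)
    finally show ?thesis .
  qed
  have per: "\<bar>\<Sum>w<W. ?f (x + N + ?q\<^sup>2 * w)\<bar> = \<bar>\<Sum>w<W. ?f (x + ?q\<^sup>2 * w)\<bar>" for x
  proof -
    have "?f (x + N + ?q\<^sup>2 * w) = ?f (x + ?q\<^sup>2 * w)" for w
      using balanced_indicator_periodic[of A N \<delta> "x + ?q\<^sup>2 * w"] by (simp add: ac_simps)
    then show ?thesis by simp
  qed
  have "(\<Sum>x<N. \<bar>\<Sum>z<?q * W. ?f (x + ?q * z)\<bar>)
      \<le> (\<Sum>x<N. \<Sum>s<?q. \<bar>\<Sum>w<W. ?f (x + ?q * s + ?q\<^sup>2 * w)\<bar>)"
    unfolding split by (intro sum_mono sum_abs)
  also have "\<dots> = (\<Sum>s<?q. \<Sum>x<N. \<bar>\<Sum>w<W. ?f (x + ?q * s + ?q\<^sup>2 * w)\<bar>)"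
    by (rule sum.swap)
  also have "\<dots> = (\<Sum>s<?q. \<Sum>x<N. \<bar>\<Sum>w<W. ?f (x + ?q\<^sup>2 * w)\<bar>)"
    using sum_shift_periodic[of "\<lambda>x. \<bar>\<Sum>w<W. ?f (x + ?q\<^sup>2 * w)\<bar>" N, OF per] by simp
  also have "\<dots> \<le> (\<Sum>s<?q. real W * (3 * \<eta> * N + real (2 * ?q\<^sup>2 * W)))"
    by (intro sum_mono L1_along_square_progressions[OF ext A \<delta> \<eta>]) (use k in simp_all)
  finally show ?thesis
    by (simp add: mult.assoc)
qed

text \<open>The factor \<open>fact H\<close> in \<open>Z\<close> makes \<open>Z\<close> divisible by \<open>2 k\<close> for all \<open>k < H\<close> at once, with a quotient of
  at least \<open>n0\<close>.\<close>

lemma mean_square_shifts_small: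
  fixes \<delta> \<eta> :: real and N Z H L n0 :: nat
  assumes ext: "\<And>n B. n \<ge> n0 \<Longrightarrow> B \<subseteq> {..<n} \<Longrightarrow> square_difference_free B \<Longrightarrow> card B \<le> (\<delta> + \<eta>) * n"
    and A: "A \<subseteq> {..<N}" "square_difference_free A" "card A \<ge> (\<delta> - \<eta>) * N"
    and \<delta>: "0 \<le> \<delta>" "\<delta> \<le> 1" and \<eta>: "\<eta> \<ge> 0"
    and Z: "Z = 2 * fact H * L" "L \<ge> n0" and N: "4 * H * Z \<le> \<eta> * N"
  shows "(\<Sum>x<N. (\<Sum>z<Z. \<Sum>h<H. balanced_indicator A N \<delta> (x + (z + h + 1)\<^sup>2))\<^sup>2)
           \<le> real (N * Z\<^sup>2) * (H + 4 * \<eta> * H\<^sup>2)"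
proof (rule van_der_Corput_squares)
  fix k assume k: "k \<in> {1..<H}"
  then have "k dvd fact H"
    by (intro dvd_fact) auto
  then obtain m where m: "fact H = k * m"
    by (elim dvdE)
  define W where "W = m * L"
  have Z_eq: "Z = 2 * k * W"
    by (simp add: Z W_def m ac_simps)
  have "m \<noteq> 0"
    using m by (metis fact_nonzero mult_0_right)
  then have "1 * L \<le> W"
    unfolding W_def by (intro mult_right_mono) auto
  then have "W \<ge> n0"
    using Z by simp
  have "k * Z \<le> H * Z"
    using k by simp
  then have "4 * k * real Z \<le> 4 * H * real Z"
    by (metis mult.assoc mult_left_mono of_nat_mult of_nat_mono zero_le_numeral)
  then have "real (2 * (2 * k)\<^sup>2 * W) \<le> \<eta> * N"
    using N by (simp add: Z_eq power2_eq_square)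
  then have le: "real (2 * k * W) * (3 * \<eta> * N + real (2 * (2 * k)\<^sup>2 * W)) \<le> real (2 * k * W) * (3 * \<eta> * N + \<eta> * N)"
    by (intro mult_left_mono) auto
  have "(\<Sum>x<N. \<bar>\<Sum>z<2 * k * W. balanced_indicator A N \<delta> (x + 2 * k * z)\<bar>)
      \<le> real (2 * k * W) * (3 * \<eta> * N + real (2 * (2 * k)\<^sup>2 * W))"
    by (intro L1_along_progressions[OF ext[OF \<open>W \<ge> n0\<close>] A \<delta> \<eta>]) (use k in simp_all)
  also note le
  also have "real (2 * k * W) * (3 * \<eta> * N + \<eta> * N) = 4 * \<eta> * N * Z"
    by (simp add: Z_eq algebra_simps)
  finally show "(\<Sum>x<N. \<bar>\<Sum>z<Z. balanced_indicator A N \<delta> (x + 2 * k * z)\<bar>) \<le> 4 * \<eta> * N * Z"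
    by (simp only: Z_eq)
qed (use \<delta> \<eta> in \<open>simp_all add: balanced_indicator_periodic abs_balanced_indicator_le_1\<close>)

section \<open>The Furstenberg-Sarkozy theorem\<close>

text \<open>The correlation of \<open>1\<^sub>A\<close> with the average of its shifts by squares is computed in two ways. Apart from
  the \<open>(Z + H)\<^sup>2\<close> points near the end of the interval it is \<open>0\<close>, because \<open>A\<close> has no square differences; and it is
  \<open>\<delta> \<bar>A\<bar>\<close> up to the mean square error.\<close>

lemma square_difference_free_size_bound:
  fixes \<delta> \<kappa> :: real and N Z H :: nat
  assumes A: "A \<subseteq> {..<N}" "square_difference_free A" and HZ: "H > 0" "Z > 0" and "\<delta> \<ge> 0" "\<kappa> \<ge> 0"
    and ms: "(\<Sum>x<N. (\<Sum>z<Z. \<Sum>h<H. balanced_indicator A N \<delta> (x + (z + h + 1)\<^sup>2))\<^sup>2)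
           \<le> real (N * Z\<^sup>2) * (real (H\<^sup>2) * \<kappa>\<^sup>2)"
  shows "\<delta> * card A \<le> real ((Z + H)\<^sup>2) + \<kappa> * N"
proof -
  let ?f = "balanced_indicator A N \<delta>" and ?g = "indicator A :: nat \<Rightarrow> real"
  define F where "F x = (\<Sum>z<Z. \<Sum>h<H. ?f (x + (z + h + 1)\<^sup>2))" for x
  have cardA: "(\<Sum>x<N. ?g x) = card A"
    using A(1) by (simp add: indicator_def sum.If_cases Int_absorb1)
  have shift: "(\<Sum>x<N. ?g x * ?f (x + m\<^sup>2)) \<le> (Z + H)\<^sup>2 - \<delta> * card A" if m: "0 < m" "m \<le> Z + H" for m
  proof -
    have "card {x. x < N \<and> N - m\<^sup>2 \<le> x} \<le> card {N - m\<^sup>2..<N}"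
      by (intro card_mono) auto
    also have "\<dots> \<le> m\<^sup>2"
      by simp
    also have "\<dots> \<le> (Z + H)\<^sup>2"
      using m by (intro power_mono) auto
    finally have bad: "real (card {x. x < N \<and> N - m\<^sup>2 \<le> x}) \<le> real ((Z + H)\<^sup>2)"
      by (rule of_nat_mono)
    have "?g x * indicator A ((x + m\<^sup>2) mod N) \<le> (if N - m\<^sup>2 \<le> x then 1 else 0)" if "x < N" for x
    proof (cases "N - m\<^sup>2 \<le> x")
      case False
      then have "(x + m\<^sup>2) mod N = x + m\<^sup>2"
        by simp
      then show ?thesis
        using A(2) m by (auto simp: square_difference_free_def indicator_def)
    qed (simp add: indicator_def)
    then have "(\<Sum>x<N. ?g x * indicator A ((x + m\<^sup>2) mod N)) \<le> (\<Sum>x<N. if N - m\<^sup>2 \<le> x then 1 else 0)"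
      by (intro sum_mono) auto
    also have "\<dots> = card {x. x < N \<and> N - m\<^sup>2 \<le> x}"
      by (simp add: sum.If_cases Int_def)
    finally show ?thesis
      using bad cardA
      by (simp add: balanced_indicator_def right_diff_distrib sum_subtractf flip: sum_distrib_right)
  qed
  have "(\<Sum>x<N. ?g x * F x) = (\<Sum>x<N. \<Sum>z<Z. \<Sum>h<H. ?g x * ?f (x + (z + h + 1)\<^sup>2))"
    by (simp add: F_def sum_distrib_left)
  also have "\<dots> = (\<Sum>z<Z. \<Sum>x<N. \<Sum>h<H. ?g x * ?f (x + (z + h + 1)\<^sup>2))"
    by (rule sum.swap)
  also have "\<dots> = (\<Sum>z<Z. \<Sum>h<H. \<Sum>x<N. ?g x * ?f (x + (z + h + 1)\<^sup>2))"
    by (rule sum.cong[OF refl], rule sum.swap)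
  also have "\<dots> \<le> (\<Sum>z<Z. \<Sum>h<H. (Z + H)\<^sup>2 - \<delta> * card A)"
    by (intro sum_mono shift) auto
  finally have upper: "(\<Sum>x<N. ?g x * F x) \<le> Z * H * ((Z + H)\<^sup>2 - \<delta> * card A)"
    by simp
  have "(\<Sum>x<N. ?g x * F x)\<^sup>2 \<le> (\<Sum>x<N. (?g x)\<^sup>2) * (\<Sum>x<N. (F x)\<^sup>2)"
    by (rule Cauchy_Schwarz_ineq_sum)
  also have "\<dots> \<le> N * (real (N * Z\<^sup>2) * (real (H\<^sup>2) * \<kappa>\<^sup>2))"
  proof (intro mult_mono)
    have "(\<Sum>x<N. (?g x)\<^sup>2) \<le> (\<Sum>x<N. 1)"
      by (intro sum_mono) (simp add: indicator_def)
    then show "(\<Sum>x<N. (?g x)\<^sup>2) \<le> N"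
      by simp
  qed (use ms in \<open>simp_all add: F_def sum_nonneg\<close>)
  also have "\<dots> = (Z * H * (\<kappa> * N))\<^sup>2"
    by (simp add: power2_eq_square)
  finally have "\<bar>\<Sum>x<N. ?g x * F x\<bar> \<le> Z * H * (\<kappa> * N)"
    using \<open>\<kappa> \<ge> 0\<close> by (simp add: abs_le_square_iff[symmetric] abs_mult)
  then have "(Z * H) * (\<delta> * card A) \<le> (Z * H) * ((Z + H)\<^sup>2 + \<kappa> * N)"
    using upper by (simp add: algebra_simps)
  then show ?thesis
    using HZ by (simp add: mult_le_cancel_left)
qed

text \<open>The extremal density \<open>\<delta>\<close> is the supremum of the densities that sets without square differences
  attain in arbitrarily long intervals. If it were positive, a nearly extremal set would satisfy
  \<open>\<delta> \<bar>A\<bar> \<le> \<delta>\<^sup>2 N / 4 + O(1)\<close> although \<open>\<bar>A\<bar> \<ge> \<delta> N / 2\<close>. The parameters are chosen in the order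
  \<open>\<eta>, n0, H, Z, N\<close>; \<open>N\<close> may be taken last, because \<open>Z\<close> does not have to grow with \<open>N\<close>.\<close>

theorem furstenberg_sarkozy:
  fixes \<delta>0 :: real
  assumes "\<delta>0 > 0"
  shows "\<exists>n0. \<forall>n\<ge>n0. \<forall>A\<subseteq>{..<n}. \<delta>0 * real n \<le> card A \<longrightarrow> \<not> square_difference_free A"
proof (rule ccontr)
  define S where "S = {s::real. \<forall>m. \<exists>n\<ge>m. \<exists>A\<subseteq>{..<n}. square_difference_free A \<and> s * real n \<le> card A}"
  define \<delta> where "\<delta> = Sup S"
  \<comment> \<open>\<open>\<eta>\<close> and \<open>H\<close> are chosen so that \<open>1 / H + 4 \<eta> \<le> (\<delta>\<^sup>2 / 4)\<^sup>2\<close>.\<close>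
  define \<eta> where "\<eta> = \<delta> ^ 4 / 256"
  assume "\<not> ?thesis"
  then have "\<delta>0 \<in> S"
    unfolding S_def by blast
  have S_le_1: "s \<le> 1" if s: "s \<in> S" for s
  proof -
    obtain n A where n: "n \<ge> 1" and A: "A \<subseteq> {..<n}" "s * real n \<le> card A"
      using s unfolding S_def by blast
    have "card A \<le> n"
      using card_mono[OF _ A(1)] by simp
    then have "s * real n \<le> 1 * n"
      using A(2) by simp
    then show ?thesis
      using n by (simp add: mult_le_cancel_right)
  qed
  then have bdd: "bdd_above S"
    by (rule bdd_aboveI)
  have "\<delta>0 \<le> \<delta>"
    unfolding \<delta>_def by (rule cSup_upper[OF \<open>\<delta>0 \<in> S\<close> bdd])
  then have \<delta>: "\<delta> > 0"
    using assms by simp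
  have "\<delta> \<le> 1"
    unfolding \<delta>_def using \<open>\<delta>0 \<in> S\<close> S_le_1 by (intro cSup_least) auto
  have \<eta>: "\<eta> > 0"
    using \<delta> by (simp add: \<eta>_def)
  have "\<delta> ^ 4 \<le> \<delta> ^ 1"
    using \<delta> \<open>\<delta> \<le> 1\<close> by (intro power_decreasing) auto
  then have \<eta>_le: "\<eta> \<le> \<delta> / 2"
    using \<delta> by (simp add: \<eta>_def)
  have "\<delta> + \<eta> \<notin> S"
    using cSup_upper[OF _ bdd, of "\<delta> + \<eta>"] \<eta> by (auto simp: \<delta>_def)
  then obtain n0 where n0: "\<And>n A. n \<ge> n0 \<Longrightarrow> A \<subseteq> {..<n} \<Longrightarrow> square_difference_free A \<Longrightarrow> \<not> (\<delta> + \<eta>) * n \<le> card A"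
    unfolding S_def by blast
  obtain s where s: "s \<in> S" "s > \<delta> - \<eta>"
    using less_cSup_iff[OF _ bdd, of "\<delta> - \<eta>"] \<open>\<delta>0 \<in> S\<close> \<eta> by (auto simp: \<delta>_def)
  obtain H :: nat where H: "64 / \<delta> ^ 4 < H"
    using reals_Archimedean2 by blast
  then have "H > 0"
    using \<delta> by (cases H) (auto simp: field_simps)
  define L where "L = max n0 1"
  define Z where "Z = 2 * fact H * L"
  have "Z > 0"
    by (simp add: Z_def L_def)
  obtain m :: nat where m: "max (4 * H * Z / \<eta>) (4 * (Z + H)\<^sup>2 / \<delta>\<^sup>2) < m"
    using reals_Archimedean2 by blast
  obtain N A where N: "N \<ge> m" and A: "A \<subseteq> {..<N}" "square_difference_free A" and "s * real N \<le> card A"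
    using s(1) unfolding S_def by blast
  have "real m \<le> real N"
    using N by simp
  then have N1: "4 * H * Z / \<eta> \<le> N" and N2: "4 * (Z + H)\<^sup>2 / \<delta>\<^sup>2 < N"
    using m by linarith+
  have cardA: "(\<delta> - \<eta>) * N \<le> card A"
    using s(2) \<open>s * real N \<le> card A\<close> by (meson less_imp_le mult_right_mono of_nat_0_le_iff order_trans)
  have "(\<Sum>x<N. (\<Sum>z<Z. \<Sum>h<H. balanced_indicator A N \<delta> (x + (z + h + 1)\<^sup>2))\<^sup>2)
           \<le> real (N * Z\<^sup>2) * (H + 4 * \<eta> * H\<^sup>2)"
  proof (rule mean_square_shifts_small)
    show "card B \<le> (\<delta> + \<eta>) * n" if "n \<ge> n0" "B \<subseteq> {..<n}" "square_difference_free B" for n B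
      using n0[OF that] by simp
    show "4 * H * Z \<le> \<eta> * N"
      using N1 \<eta> by (simp add: field_simps)
  qed (use A cardA \<delta> \<open>\<delta> \<le> 1\<close> \<eta> in \<open>auto simp: Z_def L_def\<close>)
  also have "\<dots> \<le> real (N * Z\<^sup>2) * (real (H\<^sup>2) * (\<delta>\<^sup>2 / 4)\<^sup>2)"
  proof (intro mult_left_mono)
    have "real H \<le> H * (H * (\<delta> ^ 4 / 64))"
      using H \<delta> \<open>H > 0\<close> by (simp add: field_simps)
    also have "\<dots> = H\<^sup>2 * (\<delta> ^ 4 / 64)"
      by (simp add: power2_eq_square)
    finally have "H + 4 * \<eta> * H\<^sup>2 \<le> H\<^sup>2 * (\<delta> ^ 4 / 64 + \<delta> ^ 4 / 64)"
      by (simp add: \<eta>_def algebra_simps)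
    also have "\<dots> \<le> H\<^sup>2 * (\<delta>\<^sup>2 / 4)\<^sup>2"
      using \<delta> by (intro mult_left_mono) (simp_all add: power_divide flip: power_mult)
    finally show "H + 4 * \<eta> * H\<^sup>2 \<le> H\<^sup>2 * (\<delta>\<^sup>2 / 4)\<^sup>2" .
  qed simp
  finally have "\<delta> * card A \<le> real ((Z + H)\<^sup>2) + (\<delta>\<^sup>2 / 4) * N"
    by (intro square_difference_free_size_bound A \<open>H > 0\<close> \<open>Z > 0\<close>) (use \<delta> in auto)
  moreover have "\<delta> * (\<delta> / 2 * N) \<le> \<delta> * card A"
  proof -
    have "\<delta> / 2 * N \<le> (\<delta> - \<eta>) * N"
      using \<eta>_le by (intro mult_right_mono) auto
    then show ?thesis
      using cardA \<delta> by (intro mult_left_mono) auto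
  qed
  ultimately have "\<delta>\<^sup>2 * N \<le> 4 * (Z + H)\<^sup>2"
    by (simp add: power2_eq_square algebra_simps)
  then show False
    using N2 \<delta> by (simp add: field_simps)
qed

section \<open>Popular square differences\<close>

lemma cover_pigeonhole:
  assumes I: "finite I" and F: "\<And>i. i \<in> I \<Longrightarrow> finite (F i)"
    and G: "G \<subseteq> (\<Union>i\<in>I. F i)" "G \<noteq> {}"
  shows "\<exists>i\<in>I. card G \<le> card I * card (F i)"
proof (rule ccontr)
  assume "\<not> ?thesis"
  then have less: "card I * card (F i) < card G" if "i \<in> I" for i
    using that by (simp add: not_le)
  have "card G \<le> card (\<Union>i\<in>I. F i)"
    using G(1) I F by (intro card_mono) auto
  also have "\<dots> \<le> (\<Sum>i\<in>I. card (F i))"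
    by (rule card_UN_le[OF I])
  finally have "card I * card G \<le> (\<Sum>i\<in>I. card I * card (F i))"
    by (simp flip: sum_distrib_left)
  also have "\<dots> < (\<Sum>i\<in>I. card G)"
    using G I less by (intro sum_strict_mono) auto
  finally show False
    by simp
qed

text \<open>Recurrence for a sequence of dense sets: many points \<open>\<omega>\<close> lie in \<open>E t\<close> for a set of times \<open>t < n\<close> of
  density at least \<open>\<rho> / 2\<close>, and the Furstenberg-Sarkozy theorem provides two such times that differ by a
  square. The bound \<open>n\<close> does not depend on \<open>\<Omega>\<close>, so one pair of times serves a positive proportion of the points.\<close>

lemma square_recurrence:
  fixes \<rho> :: real
  assumes \<rho>: "\<rho> > 0"
  obtains n :: nat where "n \<ge> 1"
    "\<And>(\<Omega>::'a set) E. finite \<Omega> \<Longrightarrow> \<Omega> \<noteq> {} \<Longrightarrow>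
       (\<And>t. t < n \<Longrightarrow> E t \<subseteq> \<Omega>) \<Longrightarrow> (\<And>t. t < n \<Longrightarrow> \<rho> * card \<Omega> \<le> card (E t)) \<Longrightarrow>
       \<exists>t. \<exists>z\<in>{1..n}. \<rho> / (2 * real n ^ 2) * card \<Omega> \<le> card (E t \<inter> E (t + z\<^sup>2))"
proof -
  obtain n0 where n0: "\<And>n A. n \<ge> n0 \<Longrightarrow> A \<subseteq> {..<n} \<Longrightarrow> \<rho> / 2 * real n \<le> card A \<Longrightarrow> \<not> square_difference_free A"
    using furstenberg_sarkozy[of "\<rho> / 2"] \<rho> by auto
  define n where "n = max n0 1"
  show thesis
  proof (rule that[of n])
    show "n \<ge> 1"
      by (simp add: n_def)
  next
    fix \<Omega> :: "'a set" and E
    assume \<Omega>: "finite \<Omega>" "\<Omega> \<noteq> {}"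
      and E: "\<And>t. t < n \<Longrightarrow> E t \<subseteq> \<Omega>" "\<And>t. t < n \<Longrightarrow> \<rho> * card \<Omega> \<le> card (E t)"
    define T where "T \<omega> = {t. t < n \<and> \<omega> \<in> E t}" for \<omega>
    define G where "G = {\<omega> \<in> \<Omega>. \<rho> / 2 * real n \<le> card (T \<omega>)}"
    have T_le: "card (T \<omega>) \<le> n" for \<omega>
      using card_mono[of "{..<n}" "T \<omega>"] by (auto simp: T_def)
    have "n * (\<rho> * card \<Omega>) = (\<Sum>t<n. \<rho> * card \<Omega>)"
      by simp
    also have "\<dots> \<le> (\<Sum>t<n. real (card (E t)))"
      by (intro sum_mono E) auto
    also have "\<dots> = (\<Sum>t<n. \<Sum>\<omega>\<in>\<Omega>. indicator (E t) \<omega>)"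
      using \<Omega>(1) E(1) by (intro sum.cong) (auto simp: indicator_def sum.If_cases Int_absorb1)
    also have "\<dots> = (\<Sum>\<omega>\<in>\<Omega>. \<Sum>t<n. indicator (E t) \<omega>)"
      by (rule sum.swap)
    also have "\<dots> = (\<Sum>\<omega>\<in>\<Omega>. real (card (T \<omega>)))"
      by (intro sum.cong) (auto simp: indicator_def sum.If_cases T_def Int_def)
    also have "\<dots> \<le> (\<Sum>\<omega>\<in>\<Omega>. (if \<omega> \<in> G then real n else 0) + \<rho> / 2 * n)"
      using T_le \<rho> by (intro sum_mono) (auto simp: G_def add_increasing2)
    also have "\<dots> = n * (card G + \<rho> / 2 * card \<Omega>)"
    proof -
      have "\<Omega> \<inter> {\<omega>. \<omega> \<in> G} = G"
        by (auto simp: G_def)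
      then show ?thesis
        using \<Omega>(1) by (simp add: sum.distrib sum.If_cases algebra_simps)
    qed
    finally have "\<rho> * card \<Omega> \<le> card G + \<rho> / 2 * card \<Omega>"
      by (rule mult_left_le_imp_le) (simp add: n_def)
    then have G_large: "\<rho> / 2 * card \<Omega> \<le> card G"
      by simp
    moreover have "\<rho> / 2 * card \<Omega> > 0"
      using \<rho> \<Omega> by (simp add: card_gt_0_iff)
    ultimately have "G \<noteq> {}"
      by auto
    define I where "I = {(t, z). t < n \<and> z \<in> {1..n} \<and> t + z\<^sup>2 < n}"
    have I_sub: "I \<subseteq> {..<n} \<times> {1..n}"
      by (auto simp: I_def)
    have "finite I"
      by (rule finite_subset[OF I_sub]) simp
    have "card I \<le> n\<^sup>2"
      using card_mono[OF _ I_sub] by (simp add: power2_eq_square)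
    have "\<exists>i\<in>I. card G \<le> card I * card (case i of (t, z) \<Rightarrow> E t \<inter> E (t + z\<^sup>2))"
    proof (rule cover_pigeonhole[OF \<open>finite I\<close>])
      show "finite (case i of (t, z) \<Rightarrow> E t \<inter> E (t + z\<^sup>2))" if "i \<in> I" for i
        using that E(1) \<Omega>(1) by (auto simp: I_def intro: finite_subset)
      show "G \<subseteq> (\<Union>i\<in>I. case i of (t, z) \<Rightarrow> E t \<inter> E (t + z\<^sup>2))"
      proof
        fix \<omega> assume "\<omega> \<in> G"
        then have "\<not> square_difference_free (T \<omega>)"
          by (intro n0[of n]) (auto simp: G_def T_def n_def)
        then obtain t z where tz: "t \<in> T \<omega>" "z > 0" "t + z\<^sup>2 \<in> T \<omega>"
          by (auto simp: square_difference_free_def)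
        have "z \<le> z\<^sup>2"
          by (simp add: power2_eq_square)
        then have "(t, z) \<in> I"
          using tz by (auto simp: I_def T_def)
        then show "\<omega> \<in> (\<Union>i\<in>I. case i of (t, z) \<Rightarrow> E t \<inter> E (t + z\<^sup>2))"
          using tz by (auto simp: T_def intro!: bexI[of _ "(t, z)"])
      qed
    qed fact
    then obtain t z where tz: "(t, z) \<in> I" and "card G \<le> card I * card (E t \<inter> E (t + z\<^sup>2))"
      by auto
    then have "card G \<le> n\<^sup>2 * card (E t \<inter> E (t + z\<^sup>2))"
      using \<open>card I \<le> n\<^sup>2\<close> by (meson mult_le_mono1 order_trans)
    then have "real (card G) \<le> real n ^ 2 * card (E t \<inter> E (t + z\<^sup>2))"
      by (metis of_nat_le_iff of_nat_mult of_nat_power)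
    then have "\<rho> / 2 * card \<Omega> \<le> real n ^ 2 * card (E t \<inter> E (t + z\<^sup>2))"
      using G_large by linarith
    then have "\<rho> / (2 * real n ^ 2) * card \<Omega> \<le> card (E t \<inter> E (t + z\<^sup>2))"
      by (simp add: n_def field_simps)
    moreover have "z \<in> {1..n}"
      using tz by (auto simp: I_def)
    ultimately show "\<exists>t. \<exists>z\<in>{1..n}. \<rho> / (2 * real n ^ 2) * card \<Omega> \<le> card (E t \<inter> E (t + z\<^sup>2))"
      by blast
  qed
qed

lemma card_translate_inter_ge:
  fixes A :: "nat set"
  assumes "A \<subseteq> {..<L}"
  shows "card A \<le> card {x. x < L \<and> x + s \<in> A} + s"
proof -
  have fin: "finite {x. x < L \<and> x + s \<in> A}"
    by simp
  have "A \<subseteq> (\<lambda>x. x + s) ` {x. x < L \<and> x + s \<in> A} \<union> {..<s}"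
  proof
    fix a assume "a \<in> A"
    then show "a \<in> (\<lambda>x. x + s) ` {x. x < L \<and> x + s \<in> A} \<union> {..<s}"
      using assms by (cases "a < s") (auto intro!: image_eqI[of _ _ "a - s"])
  qed
  then have "card A \<le> card ((\<lambda>x. x + s) ` {x. x < L \<and> x + s \<in> A} \<union> {..<s})"
    by (intro card_mono) auto
  also have "\<dots> \<le> card ((\<lambda>x. x + s) ` {x. x < L \<and> x + s \<in> A}) + card {..<s}"
    by (rule card_Un_le)
  also have "\<dots> \<le> card {x. x < L \<and> x + s \<in> A} + s"
    using card_image_le[OF fin] by simp
  finally show ?thesis .
qed

text \<open>Bounding the other factors trivially does not change the proportion \<open>c\<close>. In this way one estimate in a
  product set gives an estimate in every coordinate.\<close>

lemma prod_ge_imp_factor_ge: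
  fixes s L :: "'a \<Rightarrow> real"
  assumes J: "finite J" "j \<in> J" and sL: "\<And>i. i \<in> J \<Longrightarrow> 0 \<le> s i \<and> s i \<le> L i" "\<And>i. i \<in> J \<Longrightarrow> L i > 0"
    and prod: "c * prod L J \<le> prod s J"
  shows "c * L j \<le> s j"
proof -
  have "c * L j * prod L (J - {j}) = c * prod L J"
    by (simp add: prod.remove[OF J])
  also have "\<dots> \<le> s j * prod s (J - {j})"
    using prod by (simp add: prod.remove[OF J])
  also have "\<dots> \<le> s j * prod L (J - {j})"
    using sL J by (intro mult_left_mono prod_mono) auto
  finally show ?thesis
    by (rule mult_right_le_imp_le) (use sL in \<open>auto intro: prod_pos\<close>)
qed

text \<open>The sets \<open>A j\<close> may live on intervals of very different lengths. Recurrence is applied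
  in the product of these intervals, to the set of points that the diagonal shift by \<open>d\<^sup>2 t\<close> moves into the product of
  the \<open>A j\<close>. Two times \<open>t\<close> and \<open>t + z\<^sup>2\<close> then differ by the shift \<open>(d z)\<^sup>2\<close>. The condition on \<open>d\<close> bounds
  all shifts by half of \<open>\<delta> L j\<close>, so no shift moves more than half of \<open>A j\<close> across the end of its interval.\<close>

lemma simultaneous_square_returns:
  fixes \<delta> :: real
  assumes \<delta>: "\<delta> > 0"
  obtains n :: nat and c :: real where "n \<ge> 1" "c > 0"
    "\<And>(J::'a set) (A::'a \<Rightarrow> nat set) (L::'a \<Rightarrow> nat) (d::nat). finite J \<Longrightarrow> card J = k \<Longrightarrow>
       (\<And>j. j \<in> J \<Longrightarrow> A j \<subseteq> {..<L j}) \<Longrightarrow> (\<And>j. j \<in> J \<Longrightarrow> L j > 0) \<Longrightarrow>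
       (\<And>j. j \<in> J \<Longrightarrow> \<delta> * L j \<le> card (A j)) \<Longrightarrow> (\<And>j. j \<in> J \<Longrightarrow> real (d\<^sup>2 * n) \<le> \<delta> / 2 * L j) \<Longrightarrow>
       \<exists>z\<in>{1..n}. \<forall>j\<in>J. c * L j \<le> card {x \<in> A j. x + (d * z)\<^sup>2 \<in> A j}"
proof -
  define \<rho> where "\<rho> = (\<delta> / 2) ^ k"
  have "\<rho> > 0"
    using \<delta> by (simp add: \<rho>_def)
  show thesis
  proof (rule square_recurrence[OF \<open>\<rho> > 0\<close>])
    fix n :: nat
    assume n: "n \<ge> 1" and rec:
      "\<And>(\<Omega>::('a \<Rightarrow> nat) set) E. finite \<Omega> \<Longrightarrow> \<Omega> \<noteq> {} \<Longrightarrow>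
         (\<And>t. t < n \<Longrightarrow> E t \<subseteq> \<Omega>) \<Longrightarrow> (\<And>t. t < n \<Longrightarrow> \<rho> * card \<Omega> \<le> card (E t)) \<Longrightarrow>
         \<exists>t. \<exists>z\<in>{1..n}. \<rho> / (2 * real n ^ 2) * card \<Omega> \<le> card (E t \<inter> E (t + z\<^sup>2))"
    define c where "c = \<rho> / (2 * real n ^ 2)"
    show thesis
    proof (rule that[of n c])
      show "c > 0"
        using n \<open>\<rho> > 0\<close> by (simp add: c_def)
    next
      fix J :: "'a set" and A :: "'a \<Rightarrow> nat set" and L :: "'a \<Rightarrow> nat" and d :: nat
      assume J: "finite J" "card J = k" and A: "\<And>j. j \<in> J \<Longrightarrow> A j \<subseteq> {..<L j}"
        and L: "\<And>j. j \<in> J \<Longrightarrow> L j > 0" and dens: "\<And>j. j \<in> J \<Longrightarrow> \<delta> * L j \<le> card (A j)"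
        and d: "\<And>j. j \<in> J \<Longrightarrow> real (d\<^sup>2 * n) \<le> \<delta> / 2 * L j"
      define U where "U t j = {x. x < L j \<and> x + d\<^sup>2 * t \<in> A j}" for t j
      define \<Omega> where "\<Omega> = PiE J (\<lambda>j. {..<L j})"
      define E where "E t = PiE J (U t)" for t
      have "\<exists>t. \<exists>z\<in>{1..n}. \<rho> / (2 * real n ^ 2) * card \<Omega> \<le> card (E t \<inter> E (t + z\<^sup>2))"
      proof (rule rec)
        show "finite \<Omega>"
          using J by (simp add: \<Omega>_def finite_PiE)
        show "\<Omega> \<noteq> {}"
          using L by (auto simp: \<Omega>_def PiE_eq_empty_iff lessThan_empty_iff)
        show "E t \<subseteq> \<Omega>" for t
          by (auto simp: E_def \<Omega>_def U_def intro!: PiE_mono)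
        show "\<rho> * card \<Omega> \<le> card (E t)" if "t < n" for t
        proof -
          have U_ge: "\<delta> / 2 * L j \<le> card (U t j)" if j: "j \<in> J" for j
          proof -
            have "card (A j) \<le> card (U t j) + d\<^sup>2 * t"
              unfolding U_def by (rule card_translate_inter_ge[OF A[OF j]])
            also have "\<dots> \<le> card (U t j) + d\<^sup>2 * n"
              using \<open>t < n\<close> by simp
            finally have "real (card (A j)) \<le> real (card (U t j)) + real (d\<^sup>2 * n)"
              by (metis of_nat_add of_nat_mono)
            then show ?thesis
              using dens[OF j] d[OF j] by linarith
          qed
          have "\<rho> * card \<Omega> = (\<Prod>j\<in>J. \<delta> / 2 * L j)"
            using J by (simp only: prod.distrib prod_constant) (simp add: \<rho>_def \<Omega>_def card_PiE)
          also have "\<dots> \<le> (\<Prod>j\<in>J. real (card (U t j)))"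
            using U_ge \<delta> by (intro prod_mono) auto
          also have "\<dots> = card (E t)"
            using J by (simp add: E_def card_PiE)
          finally show ?thesis .
        qed
      qed
      then obtain t z where z: "z \<in> {1..n}" and tz: "c * card \<Omega> \<le> card (E t \<inter> E (t + z\<^sup>2))"
        by (auto simp: c_def)
      have cards: "card \<Omega> = (\<Prod>j\<in>J. L j)" "card (E t \<inter> E (t + z\<^sup>2)) = (\<Prod>j\<in>J. card (U t j \<inter> U (t + z\<^sup>2) j))"
        using J by (simp_all add: \<Omega>_def E_def card_PiE PiE_Int)
      have "c * L j \<le> card {x \<in> A j. x + (d * z)\<^sup>2 \<in> A j}" if j: "j \<in> J" for j
      proof -
        have "card (U t i \<inter> U (t + z\<^sup>2) i) \<le> L i" for i
          using card_mono[of "{..<L i}" "U t i \<inter> U (t + z\<^sup>2) i"] by (auto simp: U_def)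
        then have "c * real (L j) \<le> real (card (U t j \<inter> U (t + z\<^sup>2) j))"
          using tz L by (intro prod_ge_imp_factor_ge[OF J(1) j, where L = "\<lambda>j. real (L j)"
                and s = "\<lambda>j. real (card (U t j \<inter> U (t + z\<^sup>2) j))"]) (simp_all add: cards)
        also have "card (U t j \<inter> U (t + z\<^sup>2) j) \<le> card {x \<in> A j. x + (d * z)\<^sup>2 \<in> A j}"
        proof (rule card_inj_on_le[where f = "\<lambda>x. x + d\<^sup>2 * t"])
          show "(\<lambda>x. x + d\<^sup>2 * t) ` (U t j \<inter> U (t + z\<^sup>2) j) \<subseteq> {x \<in> A j. x + (d * z)\<^sup>2 \<in> A j}"
            by (auto simp: U_def power_mult_distrib algebra_simps)
          show "finite {x \<in> A j. x + (d * z)\<^sup>2 \<in> A j}"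
            using finite_subset[OF A[OF j]] by simp
        qed simp
        finally show ?thesis
          by simp
      qed
      then show "\<exists>z\<in>{1..n}. \<forall>j\<in>J. c * L j \<le> card {x \<in> A j. x + (d * z)\<^sup>2 \<in> A j}"
        using z by blast
    qed (rule n)
  qed
qed

lemma square_diff_sum_ge:
  fixes C :: "int set" and t :: real
  assumes C: "finite C" and W: "\<And>w. w \<in> W \<Longrightarrow> int w \<in> C"
    and returns: "\<And>w. w \<in> W \<Longrightarrow> t \<le> card {x. int x \<in> C \<and> int (x + w\<^sup>2) \<in> C}"
  shows "card W * t \<le> square_diff_sum C"
proof -
  define X where "X w = {x. int x \<in> C \<and> int (x + w\<^sup>2) \<in> C}" for w
  define T where "T = {(x, y, z). x \<in> C \<and> y \<in> C \<and> z \<in> C \<and> x - y = z\<^sup>2}"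
  have fin_nat: "finite {x. int x \<in> C}"
    using finite_vimageI[OF C, of int] by (simp add: vimage_def inj_on_def)
  have finX: "finite (X w)" for w
    by (rule finite_subset[OF _ fin_nat]) (auto simp: X_def)
  have finW: "finite W"
    by (rule finite_subset[OF _ fin_nat]) (auto simp: W)
  have "T \<subseteq> C \<times> C \<times> C"
    by (auto simp: T_def)
  then have finT: "finite T"
    by (rule finite_subset) (use C in simp)
  have "card W * t = (\<Sum>w\<in>W. t)"
    by simp
  also have "\<dots> \<le> (\<Sum>w\<in>W. real (card (X w)))"
    using returns by (intro sum_mono) (simp add: X_def)
  also have "\<dots> = card (SIGMA w:W. X w)"
    using finW finX by (simp add: card_SigmaI)
  also have "\<dots> \<le> card T"
  proof (intro of_nat_mono card_inj_on_le[OF _ _ finT, where f = "\<lambda>(w, x). (int (x + w\<^sup>2), int x, int w)"])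
    show "(\<lambda>(w, x). (int (x + w\<^sup>2), int x, int w)) ` (SIGMA w:W. X w) \<subseteq> T"
      using W by (auto simp: T_def X_def)
  qed (auto simp: inj_on_def)
  finally show ?thesis
    using square_diff_sum_eq_card[OF C] by (simp add: T_def)
qed

section \<open>Passing to smaller scales\<close>

definition many_solutions :: "nat \<Rightarrow> nat \<Rightarrow> (nat \<Rightarrow> int set) \<Rightarrow> real \<Rightarrow> bool" where
  "many_solutions r N C c \<longleftrightarrow> (\<exists>j\<in>{1..r}. c * real N powr (3 / 2 ^ r) \<le> square_diff_sum (C j))"

text \<open>State of the process after \<open>m + 1\<close> classes have been found: each class \<open>j \<in> J\<close> is dense on an
  initial interval \<open>{..<L j}\<close>, and all these intervals are at least as long as the current scale, which is \<open>N\<close> to the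
  power \<open>1 / 2 ^ m\<close>.\<close>

definition dense_classes :: "nat \<Rightarrow> nat \<Rightarrow> (nat \<Rightarrow> int set) \<Rightarrow> nat \<Rightarrow> real \<Rightarrow> real \<Rightarrow> bool" where
  "dense_classes r N C m \<kappa> \<delta> \<longleftrightarrow>
     (\<exists>J L. J \<subseteq> {1..r} \<and> card J = Suc m \<and>
        (\<forall>j\<in>J. \<kappa> * real N powr (1 / 2 ^ m) \<le> real (L j) \<and>
               \<delta> * real (L j) \<le> card {x. x < L j \<and> int x \<in> C j}))"

lemma dense_classes_0:
  assumes r: "r \<ge> 1"
  shows "\<exists>\<kappa>>0. \<exists>\<delta>>0. \<forall>\<^sub>F N in sequentially. \<forall>C. colouring r {1..int N} C \<longrightarrow> dense_classes r N C 0 \<kappa> \<delta>"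
proof (intro exI conjI)
  show "\<forall>\<^sub>F N in sequentially. \<forall>C. colouring r {1..int N} C \<longrightarrow> dense_classes r N C 0 1 (1 / (2 * r))"
    using eventually_ge_at_top[of "1::nat"]
  proof eventually_elim
    case (elim N)
    show ?case
    proof (intro allI impI)
      fix C assume C: "colouring r {1..int N} C"
      have "\<exists>i\<in>{1..r}. card {1..N} \<le> card {1..r} * card {x \<in> {1..N}. int x \<in> C i}"
      proof (rule cover_pigeonhole)
        show "{1..N} \<subseteq> (\<Union>i\<in>{1..r}. {x \<in> {1..N}. int x \<in> C i})"
        proof
          fix x assume x: "x \<in> {1..N}"
          then have "int x \<in> {1..int N}"
            by auto
          then show "x \<in> (\<Union>i\<in>{1..r}. {x \<in> {1..N}. int x \<in> C i})"
            using C x unfolding colouring_def by blast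
        qed
      qed (use elim in auto)
      then obtain i where i: "i \<in> {1..r}" and "N \<le> r * card {x \<in> {1..N}. int x \<in> C i}"
        by auto
      moreover have "card {x \<in> {1..N}. int x \<in> C i} \<le> card {x. x < Suc N \<and> int x \<in> C i}"
        by (intro card_mono) auto
      ultimately have "N \<le> r * card {x. x < Suc N \<and> int x \<in> C i}"
        by (meson mult_le_mono2 order_trans)
      then have "real N \<le> r * card {x. x < Suc N \<and> int x \<in> C i}"
        by (metis of_nat_le_iff of_nat_mult)
      moreover have "real (Suc N) \<le> 2 * real N"
        using elim by simp
      ultimately have "real (Suc N) \<le> 2 * (r * card {x. x < Suc N \<and> int x \<in> C i})"
        by linarith
      then have "1 / (2 * r) * real (Suc N) \<le> card {x. x < Suc N \<and> int x \<in> C i}"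
        using r by (simp add: field_simps)
      then show "dense_classes r N C 0 1 (1 / (2 * r))"
        unfolding dense_classes_def using i by (intro exI[of _ "{i}"] exI[of _ "\<lambda>_. Suc N"]) auto
    qed
  qed
qed (use r in auto)

text \<open>One round, passing from the scale \<open>M\<^sup>2\<close> to its square root \<open>M\<close>. Every \<open>d\<close> up to \<open>D\<close>, a small multiple
  of \<open>M\<close>, has a multiple \<open>d z\<close> with \<open>z \<le> n\<close> that is popular for all classes in \<open>J\<close>. By the pigeonhole principle a positive
  proportion of the \<open>d\<close> share both \<open>z\<close> and the colour \<open>i\<close> of \<open>d z\<close>; for fixed \<open>z\<close> the numbers \<open>d z\<close> are distinct. If
  \<open>i \<in> J\<close>, each of these numbers gives at least a constant times \<open>M\<^sup>2\<close> solutions, in total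
  a constant times \<open>M\<^sup>3\<close>. Otherwise class \<open>i\<close> is new, and it is dense up to \<open>D n\<close>.\<close>

lemma dense_classes_step:
  fixes \<kappa> \<delta> :: real
  assumes m: "m < r" and \<kappa>: "\<kappa> > 0" and \<delta>: "\<delta> > 0"
  shows "\<exists>\<kappa>'>0. \<exists>\<delta>'>0. \<exists>c'>0. \<forall>\<^sub>F N in sequentially. \<forall>C. colouring r {1..int N} C \<longrightarrow>
           dense_classes r N C m \<kappa> \<delta> \<longrightarrow> many_solutions r N C c' \<or> dense_classes r N C (Suc m) \<kappa>' \<delta>'"
proof (rule simultaneous_square_returns[OF \<delta>, of "Suc m", where 'a = nat])
  fix n :: nat and c :: real
  assume n: "n \<ge> 1" and c: "c > 0" and returns: 
    "\<And>(J::nat set) (A::nat \<Rightarrow> nat set) (L::nat \<Rightarrow> nat) (d::nat). finite J \<Longrightarrow> card J = Suc m \<Longrightarrow>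
       (\<And>j. j \<in> J \<Longrightarrow> A j \<subseteq> {..<L j}) \<Longrightarrow> (\<And>j. j \<in> J \<Longrightarrow> L j > 0) \<Longrightarrow>
       (\<And>j. j \<in> J \<Longrightarrow> \<delta> * L j \<le> card (A j)) \<Longrightarrow> (\<And>j. j \<in> J \<Longrightarrow> real (d\<^sup>2 * n) \<le> \<delta> / 2 * L j) \<Longrightarrow>
       \<exists>z\<in>{1..n}. \<forall>j\<in>J. c * L j \<le> card {x \<in> A j. x + (d * z)\<^sup>2 \<in> A j}"
  \<comment> \<open>The first bound on \<open>\<epsilon>\<close> keeps the multiples \<open>d z\<close> inside \<open>{1..N}\<close>; the second makes the shifts \<open>d\<^sup>2 n\<close>
    short enough for \<open>simultaneous_square_returns\<close>.\<close>
  define \<epsilon> where "\<epsilon> = min (1 / n) (sqrt (\<delta> * \<kappa> / (2 * n)))"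
  define p :: real where "p = 1 / 2 ^ Suc m"
  define \<kappa>' where "\<kappa>' = min \<kappa> (\<epsilon> / 2)"
  define \<delta>' where "\<delta>' = min \<delta> (1 / (2 * real n ^ 2 * r))"
  define c' where "c' = \<epsilon> / (2 * r * n) * (c * \<kappa>)"
  have r: "r \<ge> 1"
    using m by simp
  have \<epsilon>: "\<epsilon> > 0"
    using \<delta> \<kappa> n by (simp add: \<epsilon>_def)
  have \<epsilon>_n: "\<epsilon> * n \<le> 1"
    using n by (auto simp: \<epsilon>_def min_def field_simps)
  have "\<epsilon>\<^sup>2 \<le> (sqrt (\<delta> * \<kappa> / (2 * n)))\<^sup>2"
    using \<epsilon> by (intro power_mono) (auto simp: \<epsilon>_def)
  then have \<epsilon>_sq: "\<epsilon>\<^sup>2 * n \<le> \<delta> / 2 * \<kappa>"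
    using \<delta> \<kappa> n by (simp add: field_simps)
  have p: "0 < p" "p \<le> 1" "2 * p = 1 / 2 ^ m" "3 / 2 ^ r \<le> 3 * p"
  proof -
    have "(2::real) ^ Suc m \<le> 2 ^ r"
      using m by (intro power_increasing) auto
    then show "3 / 2 ^ r \<le> 3 * p"
      by (simp add: p_def field_simps)
    have "(1::real) \<le> 2 ^ Suc m"
      by (rule one_le_power) simp
    then show "p \<le> 1"
      by (simp add: p_def)
  qed (simp_all add: p_def)
  have "filterlim (\<lambda>N. real N powr p) at_top sequentially"
    using p by real_asymp
  then have "\<forall>\<^sub>F N in sequentially. 1 / \<epsilon> \<le> real N powr p"
    by (simp add: filterlim_at_top)
  then have "\<forall>\<^sub>F N in sequentially. \<forall>C. colouring r {1..int N} C \<longrightarrow>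
      dense_classes r N C m \<kappa> \<delta> \<longrightarrow> many_solutions r N C c' \<or> dense_classes r N C (Suc m) \<kappa>' \<delta>'"
    using eventually_ge_at_top[of "1::nat"]
  proof eventually_elim
    case (elim N)
    define M where "M = real N powr p"
    have M: "1 \<le> \<epsilon> * M"
      using elim(1) \<epsilon> by (simp add: M_def field_simps)
    have M2: "real N powr (1 / 2 ^ m) = M\<^sup>2"
      using elim(2) unfolding M_def p(3)[symmetric] by (simp add: powr_power mult.commute)
    have "M \<le> real N powr 1"
      unfolding M_def using p elim(2) by (intro powr_mono) auto
    then have M_le: "M \<le> N"
      using elim(2) by simp
    have "1 \<le> M"
      unfolding M_def using p elim(2) by (intro ge_one_powr_ge_zero) auto
    define D where "D = nat \<lfloor>\<epsilon> * M\<rfloor>"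
    have D_pos: "D \<ge> 1"
      using M by (simp add: D_def le_nat_floor)
    have "real D = of_int \<lfloor>\<epsilon> * M\<rfloor>"
      using M by (simp add: D_def)
    then have D_le: "D \<le> \<epsilon> * M" and "\<epsilon> * M < real D + 1"
      by linarith+
    then have D_ge: "\<epsilon> / 2 * M \<le> D"
      using D_pos by simp
    have D_sq: "real (D\<^sup>2 * n) \<le> \<delta> / 2 * (\<kappa> * M\<^sup>2)"
    proof -
      have "real (D\<^sup>2 * n) \<le> (\<epsilon> * M)\<^sup>2 * n"
        using D_le by (auto intro!: mult_right_mono power_mono)
      also have "\<dots> = \<epsilon>\<^sup>2 * n * M\<^sup>2"
        by (simp add: power_mult_distrib)
      also have "\<dots> \<le> \<delta> / 2 * \<kappa> * M\<^sup>2"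
        by (intro mult_right_mono \<epsilon>_sq) simp
      finally show ?thesis
        by simp
    qed
    have D_n: "D * n \<le> N"
    proof -
      have "real (D * n) \<le> \<epsilon> * M * n"
        using D_le by (simp add: mult_right_mono)
      also have "\<dots> = \<epsilon> * n * M"
        by simp
      also have "\<dots> \<le> 1 * M"
        using \<open>1 \<le> M\<close> by (intro mult_right_mono \<epsilon>_n) simp
      finally have "real (D * n) \<le> real N"
        using M_le by simp
      then show ?thesis
        by (rule of_nat_le_iff[THEN iffD1])
    qed
    show ?case
    proof (intro allI impI)
      fix C assume C: "colouring r {1..int N} C" and "dense_classes r N C m \<kappa> \<delta>"
      then obtain J L where J: "J \<subseteq> {1..r}" "card J = Suc m"
        and L: "\<And>j. j \<in> J \<Longrightarrow> \<kappa> * M\<^sup>2 \<le> real (L j)"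
        and dens: "\<And>j. j \<in> J \<Longrightarrow> \<delta> * real (L j) \<le> card {x. x < L j \<and> int x \<in> C j}"
        unfolding dense_classes_def M2 by blast
      have "finite J"
        using J(1) finite_subset by blast
      have finC: "finite (C i)" if "i \<in> {1..r}" for i
        using C that by (intro finite_subset[of "C i" "{1..int N}"]) (auto simp: colouring_def)
      define A where "A j = {x. x < L j \<and> int x \<in> C j}" for j
      define pop where "pop w \<longleftrightarrow> (\<forall>j\<in>J. c * L j \<le> card {x \<in> A j. x + w\<^sup>2 \<in> A j})" for w
      have pop: "\<exists>z\<in>{1..n}. pop (d * z)" if d: "d \<in> {1..D}" for d
        unfolding pop_def
      proof (rule returns[OF \<open>finite J\<close> J(2)])
        fix j assume j: "j \<in> J"
        show "A j \<subseteq> {..<L j}"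
          by (auto simp: A_def)
        have "0 < \<kappa> * M\<^sup>2"
          using \<kappa> \<open>1 \<le> M\<close> by simp
        then show "0 < L j"
          using L[OF j] by simp
        show "\<delta> * L j \<le> card (A j)"
          using dens[OF j] by (simp add: A_def)
        have "d\<^sup>2 * n \<le> D\<^sup>2 * n"
          using d by (auto intro: power_mono)
        then have "real (d\<^sup>2 * n) \<le> real (D\<^sup>2 * n)"
          by (rule of_nat_mono)
        also note D_sq
        also have "\<delta> / 2 * (\<kappa> * M\<^sup>2) \<le> \<delta> / 2 * L j"
          using L[OF j] \<delta> by (intro mult_left_mono) auto
        finally show "real (d\<^sup>2 * n) \<le> \<delta> / 2 * L j" .
      qed
      define F where "F = (\<lambda>(i, z). {d \<in> {1..D}. int (d * z) \<in> C i \<and> pop (d * z)})"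
      have "\<exists>iz\<in>{1..r} \<times> {1..n}. card {1..D} \<le> card ({1..r} \<times> {1..n}) * card (F iz)"
      proof (rule cover_pigeonhole)
        show "{1..D} \<subseteq> (\<Union>iz\<in>{1..r} \<times> {1..n}. F iz)"
        proof
          fix d assume d: "d \<in> {1..D}"
          then obtain z where z: "z \<in> {1..n}" "pop (d * z)"
            using pop by blast
          have "1 \<le> d * z" "d * z \<le> D * n"
            using d z by (auto intro: mult_le_mono)
          then have "int (d * z) \<in> {1..int N}"
            using D_n by (simp del: of_nat_mult)
          then obtain i where "i \<in> {1..r}" "int (d * z) \<in> C i"
            using C unfolding colouring_def by blast
          then show "d \<in> (\<Union>iz\<in>{1..r} \<times> {1..n}. F iz)"
            using d z by (intro UN_I[of "(i, z)"]) (auto simp: F_def)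
        qed
      qed (use D_pos in \<open>auto simp: F_def\<close>)
      then obtain i z where i: "i \<in> {1..r}" and z: "z \<in> {1..n}" and F_ge: "D \<le> r * n * card (F (i, z))"
        by auto
      define W where "W = (\<lambda>d. d * z) ` F (i, z)"
      have "inj_on (\<lambda>d. d * z) (F (i, z))"
        using z by (auto simp: inj_on_def)
      then have "card W = card (F (i, z))"
        by (simp add: W_def card_image)
      then have "real D \<le> real (r * n) * card W"
        using F_ge by (metis of_nat_le_iff of_nat_mult)
      then have W_ge: "real D / (r * n) \<le> card W"
        using r n by (simp add: field_simps)
      have W: "int w \<in> C i" "pop w" "w < D * n + 1" if "w \<in> W" for w
        using that z by (auto simp: W_def F_def less_Suc_eq_le mult_le_mono)
      show "many_solutions r N C c' \<or> dense_classes r N C (Suc m) \<kappa>' \<delta>'"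
      proof (cases "i \<in> J")
        case True
        have "real N powr (3 / 2 ^ r) \<le> real N powr (3 * p)"
          using p elim(2) by (intro powr_mono) auto
        also have "\<dots> = M ^ 3"
          using elim(2) by (simp add: M_def powr_power mult.commute)
        finally have "c' * real N powr (3 / 2 ^ r) \<le> c' * M ^ 3"
          using \<epsilon> c \<kappa> by (intro mult_left_mono) (auto simp: c'_def)
        also have "\<dots> = (\<epsilon> / 2 * M) / (r * n) * (c * (\<kappa> * M\<^sup>2))"
          by (simp add: c'_def power2_eq_square power3_eq_cube ac_simps)
        also have "\<dots> \<le> real D / (r * n) * (c * L i)"
          using D_ge L[OF True] c \<kappa> by (intro mult_mono divide_right_mono) auto
        also have "\<dots> \<le> card W * (c * L i)"
          using W_ge c by (intro mult_right_mono) auto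
        also have "\<dots> \<le> square_diff_sum (C i)"
        proof (rule square_diff_sum_ge[OF finC[OF i]])
          fix w assume "w \<in> W"
          then show "int w \<in> C i"
            by (rule W)
          have "c * L i \<le> card {x \<in> A i. x + w\<^sup>2 \<in> A i}"
            using W(2)[OF \<open>w \<in> W\<close>] True by (simp add: pop_def)
          also have "card {x \<in> A i. x + w\<^sup>2 \<in> A i} \<le> card {x. int x \<in> C i \<and> int (x + w\<^sup>2) \<in> C i}"
          proof (rule card_mono)
            have "finite {x. int x \<in> C i}"
              using finite_vimageI[OF finC[OF i], of int] by (simp add: vimage_def inj_on_def)
            then show "finite {x. int x \<in> C i \<and> int (x + w\<^sup>2) \<in> C i}"
              by (rule rev_finite_subset) auto
          qed (auto simp: A_def)
          finally show "c * L i \<le> card {x. int x \<in> C i \<and> int (x + w\<^sup>2) \<in> C i}"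
            by simp
        qed
        finally show ?thesis
          using i unfolding many_solutions_def by blast
      next
        case False
        define L' where "L' = L(i := D * n + 1)"
        have new: "\<kappa>' * M \<le> L' i" "\<delta>' * L' i \<le> card {x. x < L' i \<and> int x \<in> C i}"
        proof -
          have "D * 1 \<le> D * n"
            using n by (intro mult_le_mono2)
          then have "D \<le> L' i"
            unfolding L'_def fun_upd_same by linarith
          have "\<kappa>' * M \<le> \<epsilon> / 2 * M"
            using \<open>1 \<le> M\<close> by (intro mult_right_mono) (auto simp: \<kappa>'_def)
          then show "\<kappa>' * M \<le> L' i"
            using D_ge \<open>D \<le> L' i\<close> by linarith
          have "1 \<le> D * n"
            using D_pos n by simp
          then have "L' i \<le> 2 * D * n"
            by (simp add: L'_def)
          then have "real (L' i) \<le> 2 * D * n"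
            by (metis of_nat_le_iff of_nat_mult of_nat_numeral)
          then have "\<delta>' * L' i \<le> 1 / (2 * real n ^ 2 * r) * (2 * D * n)"
            by (intro mult_mono) (auto simp: \<delta>'_def)
          also have "\<dots> = real D / (r * n)"
            using n by (simp add: power2_eq_square)
          also note W_ge
          also have "card W \<le> card {x. x < L' i \<and> int x \<in> C i}"
            using W by (intro card_mono) (auto simp: L'_def)
          finally show "\<delta>' * L' i \<le> card {x. x < L' i \<and> int x \<in> C i}"
            by simp
        qed
        have old: "\<kappa>' * M \<le> L' j" "\<delta>' * L' j \<le> card {x. x < L' j \<and> int x \<in> C j}" if j: "j \<in> J" for j
        proof -
          have L'j: "L' j = L j"
            using j False by (auto simp: L'_def)
          have "M * 1 \<le> M\<^sup>2"
            unfolding power2_eq_square using \<open>1 \<le> M\<close> by (intro mult_left_mono) auto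
          then have "\<kappa>' * M \<le> \<kappa> * M\<^sup>2"
            using \<kappa> \<open>1 \<le> M\<close> by (intro mult_mono) (auto simp: \<kappa>'_def)
          then show "\<kappa>' * M \<le> L' j"
            using L[OF j] by (simp add: L'j)
          have "\<delta>' * L j \<le> \<delta> * L j"
            by (intro mult_right_mono) (auto simp: \<delta>'_def)
          then show "\<delta>' * L' j \<le> card {x. x < L' j \<and> int x \<in> C j}"
            using dens[OF j] by (simp add: L'j)
        qed
        have "dense_classes r N C (Suc m) \<kappa>' \<delta>'"
          unfolding dense_classes_def p_def[symmetric] M_def[symmetric]
          using i J False \<open>finite J\<close> new old
          by (intro exI[of _ "insert i J"] exI[of _ L']) auto
        then show ?thesis ..
      qed
    qed
  qed
  moreover have "\<kappa>' > 0" "\<delta>' > 0" "c' > 0"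
    using \<kappa> \<delta> c \<epsilon> n r by (auto simp: \<kappa>'_def \<delta>'_def c'_def)
  ultimately show ?thesis
    by blast
qed

lemma many_solutions_or_dense_classes:
  assumes r: "r \<ge> 1" and "m \<le> r"
  shows "\<exists>\<kappa>>0. \<exists>\<delta>>0. \<exists>c>0. \<forall>\<^sub>F N in sequentially. \<forall>C. colouring r {1..int N} C \<longrightarrow>
           many_solutions r N C c \<or> dense_classes r N C m \<kappa> \<delta>"
  using \<open>m \<le> r\<close>
proof (induction m)
  case 0
  obtain \<kappa> \<delta> :: real where "\<kappa> > 0" "\<delta> > 0" and
    ev: "\<forall>\<^sub>F N in sequentially. \<forall>C. colouring r {1..int N} C \<longrightarrow> dense_classes r N C 0 \<kappa> \<delta>"
    using dense_classes_0[OF r] by blast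
  then have "\<forall>\<^sub>F N in sequentially. \<forall>C. colouring r {1..int N} C \<longrightarrow>
           many_solutions r N C 1 \<or> dense_classes r N C 0 \<kappa> \<delta>"
    by (auto elim: eventually_mono)
  then show ?case
    using \<open>\<kappa> > 0\<close> \<open>\<delta> > 0\<close> zero_less_one by blast
next
  case (Suc m)
  then obtain \<kappa> \<delta> c :: real where pos: "\<kappa> > 0" "\<delta> > 0" "c > 0" and
    ev: "\<forall>\<^sub>F N in sequentially. \<forall>C. colouring r {1..int N} C \<longrightarrow>
           many_solutions r N C c \<or> dense_classes r N C m \<kappa> \<delta>"
    by auto
  obtain \<kappa>' \<delta>' c' :: real where pos': "\<kappa>' > 0" "\<delta>' > 0" "c' > 0" and
    ev': "\<forall>\<^sub>F N in sequentially. \<forall>C. colouring r {1..int N} C \<longrightarrow>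
           dense_classes r N C m \<kappa> \<delta> \<longrightarrow> many_solutions r N C c' \<or> dense_classes r N C (Suc m) \<kappa>' \<delta>'"
    using dense_classes_step[of m r, OF _ pos(1,2)] Suc.prems by auto
  have mono: "many_solutions r N C (min c c')" if "many_solutions r N C b" "b \<in> {c, c'}" for N C b
  proof -
    have "min c c' * real N powr (3 / 2 ^ r) \<le> b * real N powr (3 / 2 ^ r)"
      using that(2) by (intro mult_right_mono) auto
    then show ?thesis
      using that(1) unfolding many_solutions_def by (meson order_trans)
  qed
  have "\<forall>\<^sub>F N in sequentially. \<forall>C. colouring r {1..int N} C \<longrightarrow>
           many_solutions r N C (min c c') \<or> dense_classes r N C (Suc m) \<kappa>' \<delta>'"
    using ev ev' by eventually_elim (use mono in blast)
  moreover have "min c c' > 0"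
    using pos pos' by simp
  ultimately show ?case
    using pos'(1,2) by blast
qed

section \<open>The number of monochromatic solutions\<close>

text \<open>After the last round there would be \<open>r + 1\<close> dense classes, which is impossible, so the bound holds without error
  term for all large \<open>N\<close>. The function \<open>\<tau>\<close> only has to make the bound trivial for the finitely many remaining \<open>N\<close>.\<close>

theorem theorem1p1:
  fixes r :: nat
  assumes "r \<ge> 1"
  shows "\<exists>(c::real) (\<tau>::nat \<Rightarrow> real).
           c > 0 \<and> (\<forall>N\<ge>1. \<tau> N \<ge> 0) \<and> \<tau> \<longlonglongrightarrow> 0 \<and>
           (\<forall>N\<ge>1. \<forall>C. colouring r {1..int N} C \<longrightarrow>
              (\<exists>j\<in>{1..r}. square_diff_sum (C j) \<ge> c * real N powr (3 / 2 ^ r) * (1 - \<tau> N)))"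
proof -
  have not_dense: "\<not> dense_classes r N C r \<kappa> \<delta>" for N C \<kappa> \<delta>
  proof
    assume "dense_classes r N C r \<kappa> \<delta>"
    then obtain J where J: "J \<subseteq> {1..r}" "card J = Suc r"
      unfolding dense_classes_def by blast
    show False
      using card_mono[OF _ J(1)] J(2) by simp
  qed
  obtain c :: real where c: "c > 0" and
    ev: "\<forall>\<^sub>F N in sequentially. \<forall>C. colouring r {1..int N} C \<longrightarrow> many_solutions r N C c"
    using many_solutions_or_dense_classes[OF assms order_refl] not_dense by auto
  obtain N0 where N0: "\<And>N C. N \<ge> N0 \<Longrightarrow> colouring r {1..int N} C \<Longrightarrow> many_solutions r N C c"
    using ev unfolding eventually_sequentially by blast
  define \<tau> :: "nat \<Rightarrow> real" where "\<tau> N = (if N < N0 then 1 else 0)" for N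
  have "\<forall>\<^sub>F N in sequentially. \<tau> N = 0"
    using eventually_ge_at_top[of N0] by eventually_elim (simp add: \<tau>_def)
  then have "\<tau> \<longlonglongrightarrow> 0"
    by (rule tendsto_eventually)
  moreover have "\<exists>j\<in>{1..r}. square_diff_sum (C j) \<ge> c * real N powr (3 / 2 ^ r) * (1 - \<tau> N)"
    if C: "colouring r {1..int N} C" for N C
  proof (cases "N < N0")
    case True
    have "square_diff_sum (C 1) \<ge> 0"
      unfolding square_diff_sum_def by (intro infsum_nonneg) auto
    then show ?thesis
      using True assms by (intro bexI[of _ 1]) (auto simp: \<tau>_def)
  next
    case False
    then show ?thesis
      using N0[OF _ C] by (simp add: \<tau>_def many_solutions_def)
  qed
  ultimately show ?thesis
    using c by (intro exI[of _ c] exI[of _ \<tau>]) (auto simp: \<tau>_def)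
qed

end
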